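(* We have $$\left\{\bar p_5(w)+\bar p_5(x)+\bar p_5(y)+\bar p_5(z):\ w,x,y,z\in\mathbb{N}\right\}=\mathbb{N}\setminus\{1,3,5,10,12,20,25,27,38,53,65,153,165\}.$$ Also, any integer $n\geq 786$ can be written as $\bar p_7(w)+\bar p_7(x)+\bar p_7(y)+\bar p_7(z)$ with $w,x,y,z\in\mathbb{N}$.
   Context: $\mathbb{N}=\{0,1,2,\ldots\}$. For an integer $m\geq 3$ and $n\in\mathbb{N}$, the second $m$-gonal numbers are $\bar p_m(n)=\frac{n((m-2)n+(m-4))}{2}$; in particular $\bar p_5(n)=\frac{n(3n+1)}2$ and $\bar p_7(n)=\frac{n(5n+3)}2$. *)

theory Defs
  imports Main
begin

text \<open>
  Intended for \<open>m \<ge> 3\<close>.  The values are taken in \<open>int\<close> because \<open>m - 4\<close> is negative for \<open>m = 3\<close>.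
  The division by 2 is exact, as the lemma below shows.
\<close>

definition second_polygonal :: "nat \<Rightarrow> nat \<Rightarrow> int" where
  "second_polygonal m n = int n * ((int m - 2) * int n + (int m - 4)) div 2"

lemma two_times_second_polygonal:
  "2 * second_polygonal m n = int n * ((int m - 2) * int n + (int m - 4))"
proof -
  have "even (int n * ((int m - 2) * int n + (int m - 4)))"
    by auto
  then show ?thesis
    by (simp add: second_polygonal_def)
qed

lemma second_polygonal_5: "second_polygonal 5 n = int n * (3 * int n + 1) div 2"
  by (simp add: second_polygonal_def)

lemma second_polygonal_7: "second_polygonal 7 n = int n * (5 * int n + 3) div 2"
  by (simp add: second_polygonal_def)

end

theory Submission
  imports Defs "HOL-Computational_Algebra.Formal_Power_Series" "HOL-Library.Nat_Bijection"
begin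

text \<open>
  Put \<open>b = w + x + y + z\<close> and \<open>a = w\<^sup>2 + x\<^sup>2 + y\<^sup>2 + z\<^sup>2\<close>. The sum of the four polygonal numbers only
  depends on \<open>a\<close> and \<open>b\<close>, and by Cauchy's lemma odd \<open>a\<close>, \<open>b\<close> with \<open>b\<^sup>2 < 4 a\<close> and \<open>3 a < b\<^sup>2 + 2 b + 4\<close>
  arise from natural numbers, because \<open>4 a - b\<^sup>2\<close> is a sum of three odd squares. A large \<open>n\<close> leaves
  enough room to choose \<open>b\<close>; the remaining \<open>n\<close> are checked by computation.

  That every \<open>8 k + 3\<close> is a sum of three odd squares is obtained without Dirichlet's theorem on
  primes. Let \<open>psi\<close> be the generating function of the triangular numbers, and let \<open>r(k)\<close> be the
  number of triples with \<open>4 a c - b\<^sup>2 = 8 k + 3\<close>, \<open>0 < b < 2 min(a, c)\<close>, which is visibly positive.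
  Two elementary arguments with bijections in the style of Liouville and Kronecker show that both \<open>psi\<^sup>4\<close> and
  \<open>psi\<close> times the generating function of \<open>r\<close> have the coefficients \<open>\<sigma>(2 k + 1)\<close>. Hence
  \<open>psi\<^sup>3\<close> is the generating function of \<open>r\<close>.
\<close>

section \<open>Counting reduced matrices of odd determinant\<close>

text \<open>Each parity class is cut into regions \<open>P\<close> given by linear inequalities, and
  regions are then matched by bijections.\<close>

definition mixed_quads :: "int \<Rightarrow> (int \<Rightarrow> int \<Rightarrow> int \<Rightarrow> int \<Rightarrow> bool) \<Rightarrow> (int \<times> int \<times> int \<times> int) set" where
  "mixed_quads n P = {(a, c, u, v). 0 < a \<and> 0 < c \<and> 0 < u \<and> 0 < v \<and> a * c + u * v = n \<and>
     odd a \<and> odd c \<and> even u \<and> odd v \<and> P a c u v}"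

definition even_quads :: "int \<Rightarrow> (int \<Rightarrow> int \<Rightarrow> int \<Rightarrow> int \<Rightarrow> bool) \<Rightarrow> (int \<times> int \<times> int \<times> int) set" where
  "even_quads n P = {(a, c, u, v). 0 < a \<and> 0 < c \<and> 0 < u \<and> 0 < v \<and> a * c + u * v = n \<and>
     odd a \<and> odd c \<and> even u \<and> even v \<and> P a c u v}"

lemma card_eq_by_inverse:
  assumes "\<And>x. x \<in> A \<Longrightarrow> f x \<in> B \<and> g (f x) = x" and "\<And>y. y \<in> B \<Longrightarrow> g y \<in> A \<and> f (g y) = y"
  shows "card A = card B"
proof (rule bij_betw_same_card)
  show "bij_betw f A B"
    by (rule bij_betw_byWitness[where f' = g]) (use assms in auto)
qed

lemma pos_bound:
  fixes a c u v :: int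
  assumes "0 < a" "0 < c" "0 < u" "0 < v"
  shows "a \<le> a * c + u * v" "c \<le> a * c + u * v" "u \<le> a * c + u * v" "v \<le> a * c + u * v"
proof -
  have "a * 1 \<le> a * c" "1 * c \<le> a * c" "u * 1 \<le> u * v" "1 * v \<le> u * v"
    using assms by (auto intro!: mult_mono simp del: mult_1 mult_1_right)
  moreover have "0 \<le> a * c" "0 \<le> u * v" using assms by auto
  ultimately show "a \<le> a * c + u * v" "c \<le> a * c + u * v" "u \<le> a * c + u * v" "v \<le> a * c + u * v"
    by linarith+
qed

lemma finite_mixed_quads: "finite (mixed_quads n P)"
proof (rule finite_subset)
  show "mixed_quads n P \<subseteq> {0..n} \<times> {0..n} \<times> {0..n} \<times> {0..n}"
    unfolding mixed_quads_def using pos_bound by fastforce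
qed simp

lemma finite_even_quads: "finite (even_quads n P)"
proof (rule finite_subset)
  show "even_quads n P \<subseteq> {0..n} \<times> {0..n} \<times> {0..n} \<times> {0..n}"
    unfolding even_quads_def using pos_bound by fastforce
qed simp

text \<open>
  Viewing \<open>(a, c, u, v)\<close> as a matrix of determinant \<open>a c + u v\<close>, each of the following bijections
  is a composition of elementary row and column operations (such as \<open>a \<mapsto> a - u, v \<mapsto> v + c\<close>)
  and permutations of the entries.
\<close>

lemma card_flow_1: "card (mixed_quads n (\<lambda>a c u v. c + v < a)) = card (mixed_quads n (\<lambda>a c u v. v < u \<and> v < a))"
  by (rule card_eq_by_inverse[where f = "\<lambda>(a,c,u,v). (u + c, v, a - v, c)"
        and g = "\<lambda>(a,c,u,v). (u + c, v, a - v, c)"])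
    (auto simp: mixed_quads_def algebra_simps)

lemma card_flow_2: "card (even_quads n (\<lambda>a c u v. u < c \<and> c < u + v)) = card (mixed_quads n (\<lambda>a c u v. a + c < v))"
  by (rule card_eq_by_inverse[where f = "\<lambda>(a,c,u,v). (a, c - u, u, v + a)"
        and g = "\<lambda>(a,c,u,v). (a, c + u, u, v - a)"])
    (auto simp: mixed_quads_def even_quads_def algebra_simps)

lemma card_flow_3: "card (even_quads n (\<lambda>a c u v. a < u)) = card (mixed_quads n (\<lambda>a c u v. u < a))"
  by (rule card_eq_by_inverse[where f = "\<lambda>(a,c,u,v). (c + v, a, v, u - a)"
        and g = "\<lambda>(a,c,u,v). (c, a - u, v + c, u)"])
    (auto simp: mixed_quads_def even_quads_def algebra_simps)

lemma card_flow_4: "card (even_quads n (\<lambda>a c u v. v + c < u)) = card (mixed_quads n (\<lambda>a c u v. u < v \<and> u < a))"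
  by (rule card_eq_by_inverse[where f = "\<lambda>(a,c,u,v). (a + v, c, v, u - c)"
        and g = "\<lambda>(a,c,u,v). (a - u, c, v + c, u)"])
    (auto simp: mixed_quads_def even_quads_def algebra_simps)

lemma card_flow_5: "card (mixed_quads n (\<lambda>a c u v. a < c \<and> u + 2 * a < v \<and> v < u + a + c)) =
    card (mixed_quads n (\<lambda>a c u v. a < v \<and> v < u))"
  by (rule card_eq_by_inverse[where f = "\<lambda>(a,c,u,v). (a, c + u - v + a, v - a, u + a)"
        and g = "\<lambda>(a,c,u,v). (a, c + u - v + a, v - a, u + a)"])
    (auto simp: mixed_quads_def algebra_simps)

lemma card_flow_6: "card (mixed_quads n (\<lambda>a c u v. a < c \<and> v + 2 * a < u \<and> u < v + a + c)) =
    card (mixed_quads n (\<lambda>a c u v. a < u \<and> u < v))"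
  by (rule card_eq_by_inverse[where f = "\<lambda>(a,c,u,v). (a, c + v - u + a, v + a, u - a)"
        and g = "\<lambda>(a,c,u,v). (a, c + v - u + a, v + a, u - a)"])
    (auto simp: mixed_quads_def algebra_simps)

lemma card_flow_7: "card (mixed_quads n (\<lambda>a c u v. a + c + u < v)) = card (mixed_quads n (\<lambda>a c u v. u < a \<and> u < c))"
  by (rule card_eq_by_inverse[where f = "\<lambda>(a,c,u,v). (a + u, c + u, u, v - a - c - u)"
        and g = "\<lambda>(a,c,u,v). (a - u, c - u, u, v + a + c - u)"])
    (auto simp: mixed_quads_def algebra_simps)

lemma card_flow_8: "card (mixed_quads n (\<lambda>a c u v. a + c + v < u)) = card (mixed_quads n (\<lambda>a c u v. a < u \<and> u < c))"
  by (rule card_eq_by_inverse[where f = "\<lambda>(a,c,u,v). (v, u - a, c + v, a)"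
        and g = "\<lambda>(a,c,u,v). (v, u - a, c + v, a)"])
    (auto simp: mixed_quads_def algebra_simps)

text \<open>As sums of indicators over one fixed set, linear relations between counts can be checked
  pointwise.\<close>

lemma card_mixed_quads_sum:
  "int (card (mixed_quads n P)) = (\<Sum>(a, c, u, v)\<in>mixed_quads n (\<lambda>_ _ _ _. True). of_bool (P a c u v))"
proof -
  have "mixed_quads n P = mixed_quads n (\<lambda>_ _ _ _. True) \<inter> {(a, c, u, v). P a c u v}"
    by (auto simp: mixed_quads_def)
  then have "int (card (mixed_quads n P)) = (\<Sum>x\<in>mixed_quads n (\<lambda>_ _ _ _. True). of_bool (x \<in> {(a, c, u, v). P a c u v}))"
    using finite_mixed_quads by (simp add: sum_of_bool_eq)
  also have "\<dots> = (\<Sum>(a, c, u, v)\<in>mixed_quads n (\<lambda>_ _ _ _. True). of_bool (P a c u v))"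
    by (rule sum.cong) auto
  finally show ?thesis .
qed

lemma card_even_quads_sum:
  "int (card (even_quads n P)) = (\<Sum>(a, c, u, v)\<in>even_quads n (\<lambda>_ _ _ _. True). of_bool (P a c u v))"
proof -
  have "even_quads n P = even_quads n (\<lambda>_ _ _ _. True) \<inter> {(a, c, u, v). P a c u v}"
    by (auto simp: even_quads_def)
  then have "int (card (even_quads n P)) = (\<Sum>x\<in>even_quads n (\<lambda>_ _ _ _. True). of_bool (x \<in> {(a, c, u, v). P a c u v}))"
    using finite_even_quads by (simp add: sum_of_bool_eq)
  also have "\<dots> = (\<Sum>(a, c, u, v)\<in>even_quads n (\<lambda>_ _ _ _. True). of_bool (P a c u v))"
    by (rule sum.cong) auto
  finally show ?thesis .
qed

lemma card_mixed_quads_swap: "card (mixed_quads n P) = card (mixed_quads n (\<lambda>a c u v. P c a u v))"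
  by (rule card_eq_by_inverse[where f = "\<lambda>(a,c,u,v). (c, a, u, v)" and g = "\<lambda>(a,c,u,v). (c, a, u, v)"])
    (auto simp: mixed_quads_def mult.commute)

lemma card_even_quads_swap: "card (even_quads n P) = card (even_quads n (\<lambda>a c u v. P c a u v))"
  by (rule card_eq_by_inverse[where f = "\<lambda>(a,c,u,v). (c, a, u, v)" and g = "\<lambda>(a,c,u,v). (c, a, u, v)"])
    (auto simp: even_quads_def mult.commute)

lemma card_even_quads_swap': "card (even_quads n P) = card (even_quads n (\<lambda>a c u v. P a c v u))"
  by (rule card_eq_by_inverse[where f = "\<lambda>(a,c,u,v). (a, c, v, u)" and g = "\<lambda>(a,c,u,v). (a, c, v, u)"])
    (auto simp: even_quads_def mult.commute)

text \<open>The three counts on the left become those of \<open>reduced_quads\<close> with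
  \<open>u > 0\<close>, with \<open>u < 0\<close> even and with \<open>u < 0\<close> odd. Each is a
  complement of regions moved by the flows, and everything cancels except the boundary case
  \<open>a = v\<close>.\<close>

lemma mixed_count:
  "int (card (mixed_quads n (\<lambda>a c u v. \<bar>u - v\<bar> < 2 * a \<and> \<bar>u - v\<bar> < 2 * c)))
    + int (card (mixed_quads n (\<lambda>a c u v. \<bar>a - c\<bar> < v \<and> v < a + c)))
    + int (card (even_quads n (\<lambda>a c u v. \<bar>u - v\<bar> < c \<and> c < u + v)))
    = 2 * int (card (mixed_quads n (\<lambda>a c u v. a = v \<and> v < u)))"
proof -
  define x where "x P = int (card (mixed_quads n P))" for P
  define e where "e P = int (card (even_quads n P))" for P
  let ?T = "\<lambda>_ _ _ _ :: int. True"
  \<comment> \<open>Parity excludes these equalities, so the strict inequalities below leave no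
    boundary cases.\<close>
  have neX: "a \<noteq> u \<and> c \<noteq> u \<and> u \<noteq> v \<and> u - v \<noteq> 2 * a \<and> v - u \<noteq> 2 * a \<and> u - v \<noteq> 2 * c \<and> v - u \<noteq> 2 * c
      \<and> v \<noteq> a + c \<and> a \<noteq> c + v \<and> c \<noteq> a + v \<and> v \<noteq> a + c + u \<and> u \<noteq> a + c + v"
    if "(a, c, u, v) \<in> mixed_quads n ?T" for a c u v
  proof -
    have "odd a" "odd c" "even u" "odd v" using that by (auto simp: mixed_quads_def)
    then show ?thesis
      by - (intro conjI notI; drule arg_cong[where f = even]; simp)
  qed
  have neE: "a \<noteq> u \<and> c \<noteq> u \<and> c \<noteq> u + v \<and> u \<noteq> v + c \<and> v \<noteq> u + c"
    if "(a, c, u, v) \<in> even_quads n ?T" for a c u v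
    using that unfolding even_quads_def by auto
  have X_pos: "0 < a \<and> 0 < c \<and> 0 < u \<and> 0 < v" if "(a, c, u, v) \<in> mixed_quads n ?T" for a c u v
    using that unfolding mixed_quads_def by auto
  have E_pos: "0 < a \<and> 0 < c \<and> 0 < u \<and> 0 < v" if "(a, c, u, v) \<in> even_quads n ?T" for a c u v
    using that unfolding even_quads_def by auto
  \<comment> \<open>Position of \<open>\<bar>u - v\<bar>\<close> relative to
    \<open>2 * min a c\<close> and \<open>a + c\<close>.\<close>
  have 1: "x (\<lambda>a c u v. \<bar>u - v\<bar> < 2 * a \<and> \<bar>u - v\<bar> < 2 * c)
     + (x (\<lambda>a c u v. a < c \<and> u + 2 * a < v \<and> v < u + a + c)
     + x (\<lambda>a c u v. a < c \<and> v + 2 * a < u \<and> u < v + a + c))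
     + (x (\<lambda>a c u v. c < a \<and> u + 2 * c < v \<and> v < u + c + a)
     + x (\<lambda>a c u v. c < a \<and> v + 2 * c < u \<and> u < v + c + a))
     + (x (\<lambda>a c u v. a + c + u < v) + x (\<lambda>a c u v. a + c + v < u)) = x ?T"
    unfolding x_def card_mixed_quads_sum sum.distrib[symmetric]
    by (rule sum.cong[OF refl], clarify, frule neX, drule X_pos) (simp only: prod.case of_bool_def, smt (verit))
  \<comment> \<open>Either \<open>a\<close>, \<open>c\<close>, \<open>v\<close> satisfy the strict
    triangle inequalities or one of them exceeds the sum of the others.\<close>
  have 2: "x (\<lambda>a c u v. \<bar>a - c\<bar> < v \<and> v < a + c) + x (\<lambda>a c u v. a + c < v)
     + x (\<lambda>a c u v. c + v < a) + x (\<lambda>a c u v. a + v < c) = x ?T"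
    unfolding x_def card_mixed_quads_sum sum.distrib[symmetric]
    by (rule sum.cong[OF refl], clarify, frule neX, drule X_pos) (simp only: prod.case of_bool_def, smt (verit))
  \<comment> \<open>Both sides count the quadruples with \<open>c < u + v\<close>.\<close>
  have 3: "e (\<lambda>a c u v. \<bar>u - v\<bar> < c \<and> c < u + v) + e (\<lambda>a c u v. v + c < u) + e (\<lambda>a c u v. u + c < v)
     = e (\<lambda>a c u v. c < u) + e (\<lambda>a c u v. u < c \<and> c < u + v)"
    unfolding e_def card_even_quads_sum sum.distrib[symmetric]
    by (rule sum.cong[OF refl], clarify, frule neE, drule E_pos) (simp only: prod.case of_bool_def, smt (verit))
  have 4: "x (\<lambda>a c u v. u < a \<and> u < c) + x (\<lambda>a c u v. a < u \<and> u < c) = x (\<lambda>a c u v. u < c)"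
    unfolding x_def card_mixed_quads_sum sum.distrib[symmetric]
    by (rule sum.cong[OF refl], clarify, frule neX, drule X_pos) (simp only: prod.case of_bool_def, smt (verit))
  \<comment> \<open>Compare \<open>a\<close> with \<open>min u v\<close>; equality is possible only
    with the odd entry \<open>v\<close>.\<close>
  have 5: "x (\<lambda>a c u v. a < v \<and> v < u) + x (\<lambda>a c u v. a < u \<and> u < v) + x (\<lambda>a c u v. v < u \<and> v < a)
     + x (\<lambda>a c u v. u < v \<and> u < a) + x (\<lambda>a c u v. a = v \<and> v < u) = x ?T"
    unfolding x_def card_mixed_quads_sum sum.distrib[symmetric]
    by (rule sum.cong[OF refl], clarify, frule neX, drule X_pos) (simp only: prod.case of_bool_def, smt (verit))
  have swap: "x P = x (\<lambda>a c. P c a)" "e P = e (\<lambda>a c. P c a)" "e P = e (\<lambda>a c u v. P a c v u)" for P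
    unfolding x_def e_def using card_mixed_quads_swap card_even_quads_swap card_even_quads_swap' by auto
  note flows = card_flow_1[of n] card_flow_2[of n] card_flow_3[of n] card_flow_4[of n]
    card_flow_5[of n] card_flow_6[of n] card_flow_7[of n] card_flow_8[of n]
  note flows' = flows[THEN arg_cong[of _ _ int], folded x_def e_def]
  note swaps = swap(1)[of "\<lambda>a c u v. c < a \<and> u + 2 * c < v \<and> v < u + c + a"]
    swap(1)[of "\<lambda>a c u v. c < a \<and> v + 2 * c < u \<and> u < v + c + a"]
    swap(1)[of "\<lambda>a c u v. c + v < a"] swap(1)[of "\<lambda>a c u v. u < a"]
    swap(2)[of "\<lambda>a c u v. a < u"] swap(3)[of "\<lambda>a c u v. v + c < u"]
  show ?thesis
    unfolding x_def[symmetric] e_def[symmetric]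
    \<comment> \<open>In the sum of 1, 2 and 3 the counts for \<open>u < c\<close> and for
      \<open>a + c < v\<close> cancel; what remains is twice relation 5.\<close>
    using 1 2 3 4 5 flows' swaps by linarith
qed

section \<open>Reduced quadruples and the sum of divisors\<close>

definition divisor_pairs :: "int \<Rightarrow> (int \<times> int) set" where
  "divisor_pairs n = {(a, b). 0 < a \<and> 0 < b \<and> a * b = n}"

text \<open>
  These correspond to \<open>4 a c - b\<^sup>2 + d\<^sup>2 = 4 n\<close> with \<open>0 < b < 2 min(a, c)\<close> and \<open>d > 0\<close> odd,
  via \<open>u = (d - b) / 2\<close> and \<open>v = (d + b) / 2\<close>. For odd \<open>n\<close> the remaining parity conditions are automatic:
  \<open>u v\<close> is even, so \<open>a\<close> and \<open>c\<close> are odd.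
\<close>

definition reduced_quads :: "int \<Rightarrow> (int \<Rightarrow> bool) \<Rightarrow> (int \<times> int \<times> int \<times> int) set" where
  "reduced_quads n P = {(a, c, u, v). a * c + u * v = n \<and> odd (u + v) \<and> 0 < u + v \<and> 0 < v - u \<and>
     v - u < 2 * a \<and> v - u < 2 * c \<and> P u}"

lemma finite_divisor_pairs: "finite (divisor_pairs n)"
proof (rule finite_subset)
  show "divisor_pairs n \<subseteq> {0..n} \<times> {0..n}"
  proof
    fix x assume "x \<in> divisor_pairs n"
    then obtain a b where x: "x = (a, b)" "0 < a" "0 < b" "a * b = n" by (auto simp: divisor_pairs_def)
    then have "a * 1 \<le> a * b" "1 * b \<le> a * b"
      by (auto intro!: mult_mono simp del: mult_1 mult_1_right)
    with x show "x \<in> {0..n} \<times> {0..n}" by auto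
  qed
qed simp

text \<open>Exactly one of \<open>u\<close>, \<open>v\<close> is even and is moved to the third
  place; the order \<open>u < v\<close> allows the swap to be undone.\<close>

lemma card_reduced_quads_pos:
  assumes "odd n"
  shows "card (reduced_quads n (\<lambda>u. 0 < u)) = card (mixed_quads n (\<lambda>a c u v. \<bar>u - v\<bar> < 2 * a \<and> \<bar>u - v\<bar> < 2 * c))"
  by (rule card_eq_by_inverse[where f = "\<lambda>(a,c,u,v). if even u then (a, c, u, v) else (a, c, v, u)"
        and g = "\<lambda>(a,c,u,v). if u < v then (a, c, u, v) else (a, c, v, u)"])
    (use assms in \<open>auto simp: reduced_quads_def mixed_quads_def mult.commute not_less order_le_less split: if_splits\<close>)

text \<open>The substitution is an involution preserving \<open>a * c + u * v\<close>. Positivity of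
  \<open>a + u\<close> follows from \<open>- u < v\<close> and \<open>v - u < 2 * a\<close>.\<close>

lemma card_reduced_quads_neg_even:
  assumes "odd n"
  shows "card (reduced_quads n (\<lambda>u. u < 0 \<and> even u)) = card (mixed_quads n (\<lambda>a c u v. \<bar>a - c\<bar> < v \<and> v < a + c))"
  by (rule card_eq_by_inverse[where f = "\<lambda>(a,c,u,v). (a + u, c + u, - u, a + c + u - v)"
        and g = "\<lambda>(a,c,u,v). (a + u, c + u, - u, a + c + u - v)"])
    (use assms in \<open>auto simp: reduced_quads_def mixed_quads_def algebra_simps split: if_splits\<close>)

text \<open>The same substitution as for even \<open>u\<close>, with the entries permuted: now
  \<open>a + u\<close> and \<open>c + u\<close> are even and move to the last two places.\<close>

lemma card_reduced_quads_neg_odd: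
  assumes "odd n"
  shows "card (reduced_quads n (\<lambda>u. u < 0 \<and> odd u)) = card (even_quads n (\<lambda>a c u v. \<bar>u - v\<bar> < c \<and> c < u + v))"
  by (rule card_eq_by_inverse[where f = "\<lambda>(a,c,u,v). (- u, a + c + u - v, a + u, c + u)"
        and g = "\<lambda>(a,c,u,v). (u + a, v + a, - a, u + v + a - c)"])
    (use assms in \<open>auto simp: reduced_quads_def even_quads_def algebra_simps split: if_splits\<close>)

lemma card_odd_below: "0 \<le> k \<Longrightarrow> int (card {v. odd v \<and> 0 < v \<and> v < 2 * k}) = (k::int)"
proof -
  assume "0 \<le> k"
  have "card {v. odd v \<and> 0 < v \<and> v < 2 * k} = card {1..k}"
    by (rule card_eq_by_inverse[where f = "\<lambda>v. (v + 1) div 2" and g = "\<lambda>i. 2 * i - 1"])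
       (auto elim!: oddE)
  with \<open>0 \<le> k\<close> show ?thesis by simp
qed

lemma card_even_between:
  assumes "odd a" "odd b"
  shows "2 * int (card {u. even u \<and> a < u \<and> u < b}) = max 0 (b - a)"
proof -
  have "card {u. even u \<and> a < u \<and> u < b} = card {1..(b - a) div 2}"
    by (rule card_eq_by_inverse[where f = "\<lambda>u. (u + 1 - a) div 2" and g = "\<lambda>i. a + 2 * i - 1"])
       (use assms in \<open>auto elim!: oddE evenE\<close>)
  with assms show ?thesis by (auto elim!: oddE)
qed

lemma card_reduced_quads_zero:
  "int (card (reduced_quads n (\<lambda>u. u = 0))) = (\<Sum>(a, b)\<in>divisor_pairs n. min a b)"
proof -
  have "card (reduced_quads n (\<lambda>u. u = 0)) = card (Sigma (divisor_pairs n) (\<lambda>(a, b). {v. odd v \<and> 0 < v \<and> v < 2 * min a b}))"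
    by (rule card_eq_by_inverse[where f = "\<lambda>(a,c,u,v). ((a, c), v)" and g = "\<lambda>((a,c),v). (a, c, 0, v)"])
      (auto simp: reduced_quads_def divisor_pairs_def)
  also have "int \<dots> = (\<Sum>(a, b)\<in>divisor_pairs n. int (card {v. odd v \<and> 0 < v \<and> v < 2 * min a b}))"
  proof (subst card_SigmaI)
    show "\<forall>x\<in>divisor_pairs n. finite (case x of (a, b) \<Rightarrow> {v. odd v \<and> 0 < v \<and> v < 2 * min a b})"
      by (auto intro!: finite_subset[of "{v. odd v \<and> 0 < v \<and> v < 2 * min a b}" "{0..2 * min a b}" for a b])
  qed (auto simp: finite_divisor_pairs case_prod_unfold)
  also have "\<dots> = (\<Sum>(a, b)\<in>divisor_pairs n. min a b)"
    by (rule sum.cong) (auto simp: divisor_pairs_def intro!: card_odd_below)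
  finally show ?thesis .
qed

text \<open>With \<open>a = v\<close> the equation factors as \<open>a * (c + u) = n\<close>. For
  \<open>b = c + u\<close> there are \<open>(b - a) / 2\<close> even \<open>u\<close> between the
  odd numbers \<open>a < b\<close>.\<close>

lemma card_mixed_quads_diag:
  assumes "odd n"
  shows "2 * int (card (mixed_quads n (\<lambda>a c u v. a = v \<and> v < u))) = (\<Sum>(a, b)\<in>divisor_pairs n. max 0 (b - a))"
proof -
  have "card (mixed_quads n (\<lambda>a c u v. a = v \<and> v < u)) = card (Sigma (divisor_pairs n) (\<lambda>(a, b). {u. even u \<and> a < u \<and> u < b}))"
    by (rule card_eq_by_inverse[where f = "\<lambda>(a,c,u,v). ((a, c + u), u)" and g = "\<lambda>((a,b),u). (a, b - u, u, a)"])
      (use assms in \<open>auto simp: mixed_quads_def divisor_pairs_def algebra_simps\<close>)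
  also have "int \<dots> = (\<Sum>(a, b)\<in>divisor_pairs n. int (card {u. even u \<and> a < u \<and> u < b}))"
  proof (subst card_SigmaI)
    show "\<forall>x\<in>divisor_pairs n. finite (case x of (a, b) \<Rightarrow> {u. even u \<and> a < u \<and> u < b})"
      by (auto intro!: finite_subset[of "{u. even u \<and> a < u \<and> u < b}" "{a..b}" for a b])
  qed (auto simp: finite_divisor_pairs case_prod_unfold)
  also have "2 * \<dots> = (\<Sum>(a, b)\<in>divisor_pairs n. max 0 (b - a))"
    unfolding sum_distrib_left
  proof (rule sum.cong[OF refl], clarify)
    fix a b assume "(a, b) \<in> divisor_pairs n"
    with assms have "odd a" "odd b" by (auto simp: divisor_pairs_def)
    then show "2 * int (card {u. even u \<and> a < u \<and> u < b}) = max 0 (b - a)"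
      by (rule card_even_between)
  qed
  finally show ?thesis .
qed

lemma finite_reduced_quads: "finite (reduced_quads n P)"
proof (rule finite_subset)
  let ?I = "{-4 * n..4 * n}"
  show "reduced_quads n P \<subseteq> ?I \<times> ?I \<times> ?I \<times> ?I"
  proof
    fix q assume "q \<in> reduced_quads n P"
    then obtain a c u v where q: "q = (a, c, u, v)" "a * c + u * v = n" "0 < u + v" "0 < v - u"
      "v - u < 2 * a" "v - u < 2 * c"
      by (auto simp: reduced_quads_def)
    \<comment> \<open>In these coordinates \<open>4 * n\<close> is
      \<open>x * y + x * z + y * z + d * d\<close> with all four variables at least 1, which bounds
      each of them.\<close>
    define x y z d where "x = v - u" and "y = 2 * a - x" and "z = 2 * c - x" and "d = u + v"
    have pos: "1 \<le> x" "1 \<le> y" "1 \<le> z" "1 \<le> d"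
      using q by (auto simp: x_def y_def z_def d_def)
    have "x * y + x * z + y * z + d * d = 4 * n"
      unfolding x_def y_def z_def d_def q(2)[symmetric] by (simp add: algebra_simps)
    moreover have "x * 1 \<le> x * y" "1 * y \<le> x * y" "1 * z \<le> x * z" "1 * d \<le> d * d" "0 \<le> y * z" "0 \<le> x * z" "0 \<le> d * d"
      using pos by (auto intro!: mult_mono mult_nonneg_nonneg simp del: mult_1 mult_1_right)
    ultimately have "x \<le> 4 * n" "y \<le> 4 * n" "z \<le> 4 * n" "d \<le> 4 * n"
      using pos by linarith+
    then show "q \<in> ?I \<times> ?I \<times> ?I \<times> ?I"
      using pos unfolding q(1) x_def y_def z_def d_def by auto
  qed
qed simp

lemma card_reduced_quads_split:
  assumes "\<And>u. P u \<longleftrightarrow> P1 u \<or> P2 u" "\<And>u. \<not> (P1 u \<and> P2 u)"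
  shows "int (card (reduced_quads n P)) = int (card (reduced_quads n P1)) + int (card (reduced_quads n P2))"
proof -
  have "reduced_quads n P = reduced_quads n P1 \<union> reduced_quads n P2" "reduced_quads n P1 \<inter> reduced_quads n P2 = {}"
    using assms by (auto simp: reduced_quads_def)
  then show ?thesis
    by (simp add: card_Un_disjoint finite_reduced_quads)
qed

lemma card_reduced_quads:
  assumes "odd n"
  shows "int (card (reduced_quads n (\<lambda>_. True))) = (\<Sum>(a, b)\<in>divisor_pairs n. b)"
proof -
  have "int (card (reduced_quads n (\<lambda>_. True))) = int (card (reduced_quads n (\<lambda>u. u = 0))) + int (card (reduced_quads n (\<lambda>u. u \<noteq> 0)))"
    by (rule card_reduced_quads_split) auto
  moreover have "int (card (reduced_quads n (\<lambda>u. u \<noteq> 0))) = int (card (reduced_quads n (\<lambda>u. 0 < u))) + int (card (reduced_quads n (\<lambda>u. u < 0)))"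
    by (rule card_reduced_quads_split) auto
  moreover have "int (card (reduced_quads n (\<lambda>u. u < 0)))
      = int (card (reduced_quads n (\<lambda>u. u < 0 \<and> even u))) + int (card (reduced_quads n (\<lambda>u. u < 0 \<and> odd u)))"
    by (rule card_reduced_quads_split) auto
  ultimately have "int (card (reduced_quads n (\<lambda>_. True))) = (\<Sum>(a, b)\<in>divisor_pairs n. min a b) + (\<Sum>(a, b)\<in>divisor_pairs n. max 0 (b - a))"
    unfolding card_reduced_quads_zero card_reduced_quads_pos[OF assms] card_reduced_quads_neg_even[OF assms] card_reduced_quads_neg_odd[OF assms]
    using mixed_count[of n] card_mixed_quads_diag[OF assms] by linarith
  \<comment> \<open>\<open>min a b + max 0 (b - a) = b\<close>.\<close>
  also have "\<dots> = (\<Sum>(a, b)\<in>divisor_pairs n. b)"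
    unfolding sum.distrib[symmetric] by (rule sum.cong) auto
  finally show ?thesis .
qed

section \<open>The fourth power of the generating function of the triangular numbers\<close>

unbundle fps_syntax

text \<open>The triple \<open>(a, s, c)\<close> stands for the binary form \<open>a x\<^sup>2 + s x y - c y\<^sup>2\<close> of discriminant \<open>M\<close>.\<close>

definition simple_forms :: "int \<Rightarrow> (int \<times> int \<times> int) set" where
  "simple_forms M = {(a, s, c). 0 < a \<and> 0 < c \<and> s * s + 4 * (a * c) = M}"

lemma finite_simple_forms: "finite (simple_forms M)"
proof (rule finite_subset)
  show "simple_forms M \<subseteq> {0..M} \<times> {-M..M} \<times> {0..M}"
  proof
    fix q assume "q \<in> simple_forms M"
    then obtain a s c where q: "q = (a, s, c)" "0 < a" "0 < c" "s * s + 4 * (a * c) = M"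
      by (auto simp: simple_forms_def)
    have "a * 1 \<le> a * c" "1 * c \<le> a * c"
      using q by (auto intro!: mult_mono simp del: mult_1 mult_1_right)
    moreover have "\<bar>s\<bar> * \<bar>s\<bar> = s * s"
      by simp
    moreover have "\<bar>s\<bar> \<le> \<bar>s\<bar> * \<bar>s\<bar>"
      by (cases "s = 0") (auto simp: mult_le_cancel_left1 simp del: abs_mult_self_eq)
    ultimately have "a \<le> M" "c \<le> M" "\<bar>s\<bar> \<le> M"
      using q by linarith+
    then show "q \<in> {0..M} \<times> {-M..M} \<times> {0..M}"
      using q by auto
  qed
qed simp

lemma odd_square_mod_8: "odd (x::int) \<Longrightarrow> x * x mod 8 = 1"
proof -
  assume "odd x"
  then obtain y where y: "x = 2 * y + 1" by (elim oddE)
  have "even (y * (y + 1))" by simp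
  then obtain z where "y * (y + 1) = 2 * z" by (elim evenE)
  then have "x * x = 8 * z + 1" unfolding y by (simp add: algebra_simps)
  then show ?thesis by simp
qed

text \<open>
  Up to the term \<open>s (a\<^sup>2 - c\<^sup>2)\<close>, which is odd in \<open>s\<close>, the summand is \<open>g = (a + c) (a + s) (c - s)\<close>.
  On the forms with positive value \<open>a + s - c\<close> at \<open>(1, 1)\<close>, the involution
  \<open>(a, s, c) \<mapsto> (a + s - c, 2 c - s, c)\<close> changes the sign of \<open>g\<close>.
\<close>

lemma sum_simple_forms:
  assumes "M mod 8 = 5"
  shows "(\<Sum>(a, s, c)\<in>simple_forms M. (a + c) * (a * c - s * s)) = 0"
proof -
  let ?P = "{(a, s, c). (a, s, c) \<in> simple_forms M \<and> c < a + s}"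
  let ?N = "{(a, s, c). (a, s, c) \<in> simple_forms M \<and> a + s < c}"
  define g where "g = (\<lambda>(a, s, c). (a + c) * (a + s) * (c - s) :: int)"
  define h where "h = (\<lambda>(a, s, c). s * (a * a - c * c) :: int)"
  \<comment> \<open>Otherwise \<open>M\<close> would be the odd square
    \<open>(a + c) * (a + c)\<close>, which is 1 modulo 8.\<close>
  have ne: "a + s \<noteq> c" if "(a, s, c) \<in> simple_forms M" for a s c
  proof
    assume "a + s = c"
    then have M: "M = (a + c) * (a + c)"
      using that by (auto simp: simple_forms_def algebra_simps)
    moreover have "odd M" using assms by presburger
    ultimately have "odd (a + c)" by simp
    then show False
      using odd_square_mod_8[of "a + c"] M assms by simp
  qed
  have finite: "finite ?P" "finite ?N"
    by (rule finite_subset[OF _ finite_simple_forms[of M]], force)+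
  have Q_eq: "simple_forms M = ?P \<union> ?N"
    using ne by (fastforce simp: not_less)
  have "sum h (simple_forms M) = (\<Sum>x\<in>simple_forms M. - h x)"
    by (rule sum.reindex_bij_witness[where i = "\<lambda>(a, s, c). (a, - s, c)" and j = "\<lambda>(a, s, c). (a, - s, c)"])
      (auto simp: simple_forms_def h_def)
  then have h: "sum h (simple_forms M) = 0"
    by (simp add: sum_negf)
  have "sum g ?P = (\<Sum>x\<in>?P. - g x)"
    by (rule sum.reindex_bij_witness[where i = "\<lambda>(a, s, c). (a + s - c, 2 * c - s, c)"
          and j = "\<lambda>(a, s, c). (a + s - c, 2 * c - s, c)"])
      (auto simp: simple_forms_def g_def algebra_simps)
  then have P: "sum g ?P = 0"
    by (simp add: sum_negf)
  \<comment> \<open>Negating the form and exchanging its variables changes the sign of its value at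
    \<open>(1, 1)\<close> but preserves \<open>g\<close>.\<close>
  have "sum g ?N = sum g ?P"
    by (rule sum.reindex_bij_witness[where i = "\<lambda>(a, s, c). (c, - s, a)" and j = "\<lambda>(a, s, c). (c, - s, a)"])
      (auto simp: simple_forms_def g_def algebra_simps)
  moreover have "sum g (simple_forms M) = sum g ?P + sum g ?N"
    by (subst Q_eq, rule sum.union_disjoint) (use finite in auto)
  ultimately have "sum g (simple_forms M) + sum h (simple_forms M) = 0"
    using P h by simp
  then show ?thesis
    unfolding sum.distrib[symmetric] by (simp add: g_def h_def case_prod_unfold algebra_simps)
qed

section \<open>Generating functions and the recurrence for \<sigma>(2 k + 1)\<close>

definition psi :: "int fps" where
  "psi = Abs_fps (\<lambda>i. of_bool (i \<in> range triangle))"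

lemma triangle_8: "8 * int (triangle j) + 1 = (2 * int j + 1) * (2 * int j + 1)"
  by (induction j) (auto simp: algebra_simps)

lemma le_triangle: "j \<le> triangle j"
  by (induction j) auto

lemma finite_triangle: "finite {j. triangle j \<le> N}"
  by (rule finite_subset[of _ "{..N}"]) (auto intro: order.trans[OF le_triangle])

lemma inj_triangle: "inj triangle"
  by (rule strict_mono_imp_inj_on) (auto simp: strict_mono_Suc_iff)

text \<open>The weight \<open>h\<close> covers both \<open>psi\<close> and
  \<open>fps_X * fps_deriv psi\<close>.\<close>

lemma triangle_mult_nth:
  fixes f :: "int fps"
  shows "(Abs_fps (\<lambda>i. of_bool (i \<in> range triangle) * h i) * f) $ N =
    (\<Sum>j | triangle j \<le> N. h (triangle j) * f $ (N - triangle j))"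
proof -
  have "(Abs_fps (\<lambda>i. of_bool (i \<in> range triangle) * h i) * f) $ N =
      (\<Sum>i=0..N. of_bool (i \<in> range triangle) * h i * f $ (N - i))"
    by (simp add: fps_mult_nth)
  also have "\<dots> = (\<Sum>i\<in>triangle ` {j. triangle j \<le> N}. h i * f $ (N - i))"
    by (rule sum.mono_neutral_cong_right) auto
  also have "\<dots> = (\<Sum>j | triangle j \<le> N. h (triangle j) * f $ (N - triangle j))"
    by (subst sum.reindex) (use inj_triangle in \<open>auto simp: inj_on_def\<close>)
  finally show ?thesis .
qed

lemma psi_mult_nth: "(psi * f) $ N = (\<Sum>j | triangle j \<le> N. f $ (N - triangle j))"
  using triangle_mult_nth[of "\<lambda>_. 1" f N] by (simp add: psi_def)

definition sigma_odd :: "int fps" where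
  "sigma_odd = Abs_fps (\<lambda>k. \<Sum>(a, b)\<in>divisor_pairs (2 * int k + 1). b)"

lemma fps_X_deriv_nth: "(fps_X * fps_deriv f) $ N = of_nat N * (f :: int fps) $ N"
  by (cases N) auto

text \<open>This is \<open>sigma_odd_ode\<close> read coefficientwise. If \<open>s = 2 j + 1\<close>
  and \<open>a b = 2 (N - triangle j) + 1\<close>, then \<open>(a, s, b)\<close> has discriminant
  \<open>8 N + 5\<close> and \<open>a b - s\<^sup>2 = 2 (N - 5 triangle j)\<close>, so
  \<open>sum_simple_forms\<close> applies.\<close>

lemma sum_triangle_sigma_odd:
  "(\<Sum>j | triangle j \<le> N. (int N - 5 * int (triangle j)) * sigma_odd $ (N - triangle j)) = 0"
proof -
  let ?M = "8 * int N + 5"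
  let ?J = "{j. triangle j \<le> N}"
  let ?D = "\<lambda>j. divisor_pairs (2 * int (N - triangle j) + 1)"
  define f where "f = (\<lambda>(a, s, c). c * (a * c - s * s) :: int)"
  define f' where "f' = (\<lambda>(a, s, c). a * (a * c - s * s) :: int)"
  let ?Q = "{(a, s, c). (a, s, c) \<in> simple_forms ?M \<and> 0 < s}" and ?Q' = "{(a, s, c). (a, s, c) \<in> simple_forms ?M \<and> s < 0}"
  have odd_s: "odd s" if "(a, s, c) \<in> simple_forms ?M" for a s c
  proof -
    have "s * s = 2 * (4 * int N + 2 - 2 * (a * c)) + 1"
      using that by (simp add: simple_forms_def)
    then have "odd (s * s)" by presburger
    then show ?thesis by simp
  qed
  have fin: "finite ?Q" "finite ?Q'"
    by (rule finite_subset[OF _ finite_simple_forms[of ?M]], force)+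
  have Q_eq: "simple_forms ?M = ?Q \<union> ?Q'"
    using odd_s by (force simp: not_less order_le_less)
  \<comment> \<open>Changing the sign of \<open>s\<close> and exchanging \<open>a\<close> with
    \<open>c\<close> give four equal sums, whose total is zero.\<close>
  have "sum f ?Q' = sum f ?Q" "sum f' ?Q' = sum f' ?Q"
    by (rule sum.reindex_bij_witness[where i = "\<lambda>(a, s, c). (a, - s, c)" and j = "\<lambda>(a, s, c). (a, - s, c)"];
      auto simp: simple_forms_def f_def f'_def)+
  moreover have "sum f' ?Q = sum f ?Q"
    by (rule sum.reindex_bij_witness[where i = "\<lambda>(a, s, c). (c, s, a)" and j = "\<lambda>(a, s, c). (c, s, a)"])
      (auto simp: simple_forms_def f_def f'_def algebra_simps)
  moreover have "sum f (simple_forms ?M) = sum f ?Q + sum f ?Q'" "sum f' (simple_forms ?M) = sum f' ?Q + sum f' ?Q'"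
    by (subst Q_eq, rule sum.union_disjoint; use fin in auto)+
  moreover have "sum f (simple_forms ?M) + sum f' (simple_forms ?M) = 0"
    using sum_simple_forms[of ?M] unfolding sum.distrib[symmetric]
    by (simp add: f_def f'_def case_prod_unfold algebra_simps)
  ultimately have "sum f ?Q = 0" by linarith
  have "2 * (\<Sum>j\<in>?J. (int N - 5 * int (triangle j)) * sigma_odd $ (N - triangle j))
      = (\<Sum>j\<in>?J. \<Sum>(a, b)\<in>?D j. 2 * (int N - 5 * int (triangle j)) * b)"
    by (simp add: sigma_odd_def sum_distrib_left case_prod_unfold algebra_simps)
  also have "\<dots> = (\<Sum>(j, a, b)\<in>Sigma ?J ?D. 2 * (int N - 5 * int (triangle j)) * b)"
    by (subst sum.Sigma) (auto simp: finite_triangle finite_divisor_pairs case_prod_unfold)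
  also have "\<dots> = sum f ?Q"
  proof (rule sum.reindex_bij_witness[where i = "\<lambda>(a, s, c). (nat ((s - 1) div 2), a, c)"
          and j = "\<lambda>(j, a, b). (a, 2 * int j + 1, b)"])
    fix x assume "x \<in> Sigma ?J ?D"
    then obtain j a b where x: "x = (j, a, b)" "triangle j \<le> N" "0 < a" "0 < b"
      "a * b = 2 * (int N - int (triangle j)) + 1"
      by (auto simp: divisor_pairs_def)
    show "(case case x of (j, a, b) \<Rightarrow> (a, 2 * int j + 1, b) of (a, s, c) \<Rightarrow> (nat ((s - 1) div 2), a, c)) = x"
      by (simp add: x)
    show "(case x of (j, a, b) \<Rightarrow> (a, 2 * int j + 1, b)) \<in> ?Q"
      using x triangle_8[of j] by (simp add: simple_forms_def)
    have "a * b - (2 * int j + 1) * (2 * int j + 1) = 2 * (int N - 5 * int (triangle j))"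
      unfolding x(5) triangle_8[symmetric] by simp
    then show "f (case x of (j, a, b) \<Rightarrow> (a, 2 * int j + 1, b)) = (case x of (j, a, b) \<Rightarrow> 2 * (int N - 5 * int (triangle j)) * b)"
      by (simp add: x f_def)
  next
    fix x assume "x \<in> ?Q"
    then obtain a s c where x: "x = (a, s, c)" "(a, s, c) \<in> simple_forms ?M" "0 < s" by auto
    with odd_s have "odd s" by blast
    then obtain t where "s = 2 * t + 1" by (elim oddE)
    with \<open>0 < s\<close> have j: "s = 2 * int (nat t) + 1" by simp
    define j where "j = nat t"
    note j = j[folded j_def]
    have ac: "a * c = 2 * (int N - int (triangle j)) + 1" "0 < a" "0 < c"
      using x triangle_8[of j] by (auto simp: simple_forms_def j)
    have "triangle j \<le> N"
      using mult_pos_pos[OF ac(2,3)] unfolding ac(1) by simp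
    with ac show "(case x of (a, s, c) \<Rightarrow> (nat ((s - 1) div 2), a, c)) \<in> Sigma ?J ?D"
      by (simp add: x j divisor_pairs_def of_nat_diff)
    show "(case case x of (a, s, c) \<Rightarrow> (nat ((s - 1) div 2), a, c) of (j, a, b) \<Rightarrow> (a, 2 * int j + 1, b)) = x"
      by (simp add: x j)
  qed
  finally show ?thesis
    using \<open>sum f ?Q = 0\<close> by simp
qed

section \<open>Sums of three triangular numbers\<close>

text \<open>
  With \<open>x = b\<close>, \<open>y = 2 a - b\<close>, \<open>z = 2 c - b\<close> these are the solutions of \<open>x y + y z + z x = 8 k + 3\<close>
  in positive odd integers.
\<close>

definition reduced_forms :: "nat \<Rightarrow> (int \<times> int \<times> int) set" where
  "reduced_forms k = {(a, b, c). 4 * (a * c) - b * b = 8 * int k + 3 \<and> 0 < b \<and> b < 2 * a \<and> b < 2 * c}"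

definition reduced_forms_fps :: "int fps" where
  "reduced_forms_fps = Abs_fps (\<lambda>k. int (card (reduced_forms k)))"

lemma odd_middle_coeff:
  assumes "(a, b, c) \<in> reduced_forms k"
  shows "odd b"
proof -
  have "b * b = 2 * (2 * (a * c) - 4 * int k - 2) + 1"
    using assms by (simp add: reduced_forms_def)
  then have "odd (b * b)" by presburger
  then show ?thesis by simp
qed

text \<open>Put \<open>d = 2 j + 1\<close>: since \<open>d\<^sup>2 = 8 triangle j + 1\<close>, the
  form satisfies \<open>4 a c - b\<^sup>2 + d\<^sup>2 = 4 (2 N + 1)\<close>.\<close>

lemma reduced_forms_to_quads:
  assumes "triangle j \<le> N" "(a, b, c) \<in> reduced_forms (N - triangle j)"
  shows "(a, c, (2 * int j + 1 - b) div 2, (2 * int j + 1 + b) div 2) \<in> reduced_quads (2 * int N + 1) (\<lambda>_. True)"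
proof -
  obtain t where t: "b = 2 * t + 1"
    using odd_middle_coeff[OF assms(2)] by (elim oddE)
  have "4 * (a * c) - b * b = 8 * (int N - int (triangle j)) + 3"
    using assms by (simp add: reduced_forms_def of_nat_diff)
  then have "a * c + (int j - t) * (int j + t + 1) = 2 * int N + 1"
    using triangle_8[of j] unfolding t by (simp add: algebra_simps)
  moreover have "(2 * int j + 1 - b) div 2 = int j - t" "(2 * int j + 1 + b) div 2 = int j + t + 1"
    unfolding t by simp_all
  ultimately show ?thesis
    using assms(2) by (simp add: reduced_quads_def reduced_forms_def t ac_simps)
qed

lemma reduced_quads_to_forms:
  assumes "(a, c, u, v) \<in> reduced_quads (2 * int N + 1) (\<lambda>_. True)"
  obtains j where "u + v = 2 * int j + 1" "triangle j \<le> N" "(a, v - u, c) \<in> reduced_forms (N - triangle j)"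
proof -
  from assms have uv: "a * c + u * v = 2 * int N + 1" "odd (u + v)" "0 < u + v" "0 < v - u"
    "v - u < 2 * a" "v - u < 2 * c"
    by (auto simp: reduced_quads_def)
  from uv(2) obtain t where "u + v = 2 * t + 1" by (elim oddE)
  moreover define j where "j = nat t"
  ultimately have j: "u + v = 2 * int j + 1"
    using uv(3) by simp
  have "4 * (a * c) - (v - u) * (v - u) + (u + v) * (u + v) = 4 * (2 * int N + 1)"
    unfolding uv(1)[symmetric] by (simp add: algebra_simps)
  then have eq: "4 * (a * c) - (v - u) * (v - u) = 8 * (int N - int (triangle j)) + 3"
    unfolding j triangle_8[symmetric] by simp
  have "(v - u) * (v - u) < (2 * a) * (2 * c)"
    using uv by (intro mult_strict_mono) auto
  with eq have "triangle j \<le> N"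
    by simp
  then have "(a, v - u, c) \<in> reduced_forms (N - triangle j)"
    using eq uv by (simp add: reduced_forms_def of_nat_diff)
  with j \<open>triangle j \<le> N\<close> show ?thesis
    by (rule that)
qed

text \<open>The case \<open>j = 0\<close> of the correspondence embeds these forms into a finite set
  of quadruples.\<close>

lemma finite_reduced_forms: "finite (reduced_forms k)"
proof (rule finite_subset)
  show "reduced_forms k \<subseteq> (\<lambda>(a, c, u, v). (a, v - u, c)) ` reduced_quads (2 * int k + 1) (\<lambda>_. True)"
  proof
    fix q assume "q \<in> reduced_forms k"
    then obtain a b c where q: "q = (a, b, c)" "(a, b, c) \<in> reduced_forms k"
      by (cases q) auto
    have "(1 + b) div 2 - (1 - b) div 2 = b"
      using odd_middle_coeff[OF q(2)] by (auto elim!: oddE)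
    then show "q \<in> (\<lambda>(a, c, u, v). (a, v - u, c)) ` reduced_quads (2 * int k + 1) (\<lambda>_. True)"
      using reduced_forms_to_quads[of 0 k a b c] q by (force simp: image_iff)
  qed
qed (simp add: finite_reduced_quads)

lemma psi_reduced_forms_fps: "psi * reduced_forms_fps = sigma_odd"
proof (rule fps_ext)
  fix N
  let ?J = "{j. triangle j \<le> N}"
  let ?W = "reduced_quads (2 * int N + 1) (\<lambda>_. True)"
  have "(psi * reduced_forms_fps) $ N = int (\<Sum>j\<in>?J. card (reduced_forms (N - triangle j)))"
    by (simp add: psi_mult_nth reduced_forms_fps_def)
  also have "(\<Sum>j\<in>?J. card (reduced_forms (N - triangle j))) = card (Sigma ?J (\<lambda>j. reduced_forms (N - triangle j)))"
    by (subst card_SigmaI) (auto simp: finite_triangle finite_reduced_forms)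
  also have "\<dots> = card ?W"
  proof (rule card_eq_by_inverse[where
        f = "\<lambda>(j, a, b, c). (a, c, (2 * int j + 1 - b) div 2, (2 * int j + 1 + b) div 2)"
        and g = "\<lambda>(a, c, u, v). (nat ((u + v - 1) div 2), a, v - u, c)"])
    fix x assume "x \<in> Sigma ?J (\<lambda>j. reduced_forms (N - triangle j))"
    then obtain j a b c where x: "x = (j, a, b, c)" "triangle j \<le> N" "(a, b, c) \<in> reduced_forms (N - triangle j)"
      by auto
    obtain t where t: "b = 2 * t + 1"
      using odd_middle_coeff[OF x(3)] by (elim oddE)
    show "(case x of (j, a, b, c) \<Rightarrow> (a, c, (2 * int j + 1 - b) div 2, (2 * int j + 1 + b) div 2)) \<in> ?W \<and>
      (case case x of (j, a, b, c) \<Rightarrow> (a, c, (2 * int j + 1 - b) div 2, (2 * int j + 1 + b) div 2) of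
         (a, c, u, v) \<Rightarrow> (nat ((u + v - 1) div 2), a, v - u, c)) = x"
      using reduced_forms_to_quads[OF x(2,3)] by (simp add: x(1) t)
  next
    fix y assume "y \<in> ?W"
    then obtain a c u v where y: "y = (a, c, u, v)" "(a, c, u, v) \<in> ?W"
      by (cases y) auto
    from reduced_quads_to_forms[OF y(2)] obtain j where j: "u + v = 2 * int j + 1" "triangle j \<le> N" "(a, v - u, c) \<in> reduced_forms (N - triangle j)" .
    have v: "v = 2 * int j + 1 - u" using j(1) by simp
    show "(case y of (a, c, u, v) \<Rightarrow> (nat ((u + v - 1) div 2), a, v - u, c)) \<in> Sigma ?J (\<lambda>j. reduced_forms (N - triangle j)) \<and>
      (case case y of (a, c, u, v) \<Rightarrow> (nat ((u + v - 1) div 2), a, v - u, c) of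
         (j, a, b, c) \<Rightarrow> (a, c, (2 * int j + 1 - b) div 2, (2 * int j + 1 + b) div 2)) = y"
      using j unfolding y(1) v by simp
  qed
  also have "int \<dots> = sigma_odd $ N"
    by (simp add: sigma_odd_def card_reduced_quads)
  finally show "(psi * reduced_forms_fps) $ N = sigma_odd $ N" .
qed

section \<open>The differential equation and its unique solution\<close>

lemma psi_0: "psi $ 0 = 1"
  by (simp add: psi_def image_iff exI[of _ 0])

text \<open>This is the differential equation satisfied by \<open>psi ^ 4\<close>; it determines its solution up to a constant factor.\<close>

lemma sigma_odd_ode: "psi * (fps_X * fps_deriv sigma_odd) = 4 * (fps_X * fps_deriv psi) * sigma_odd"
proof (rule fps_ext)
  fix N
  have psi': "fps_X * fps_deriv psi = Abs_fps (\<lambda>i. of_bool (i \<in> range triangle) * int i)"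
    by (rule fps_ext) (simp only: fps_X_deriv_nth psi_def fps_nth_Abs_fps mult.commute of_nat_id)
  have "(psi * (fps_X * fps_deriv sigma_odd)) $ N
      = (\<Sum>j | triangle j \<le> N. (int N - int (triangle j)) * sigma_odd $ (N - triangle j))"
    unfolding psi_mult_nth fps_X_deriv_nth by (rule sum.cong) (auto simp: of_nat_diff)
  also have "\<dots> = (\<Sum>j | triangle j \<le> N. (int N - 5 * int (triangle j)) * sigma_odd $ (N - triangle j))
      + 4 * (\<Sum>j | triangle j \<le> N. int (triangle j) * sigma_odd $ (N - triangle j))"
    unfolding sum_distrib_left sum.distrib[symmetric] by (rule sum.cong) (auto simp: algebra_simps)
  also have "\<dots> = (4 * (fps_X * fps_deriv psi) * sigma_odd) $ N"
    unfolding sum_triangle_sigma_odd psi' mult.assoc numeral_fps_const fps_mult_left_const_nth triangle_mult_nth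
    by simp
  finally show "(psi * (fps_X * fps_deriv sigma_odd)) $ N = (4 * (fps_X * fps_deriv psi) * sigma_odd) $ N" .
qed

text \<open>If all coefficients of \<open>g\<close> before \<open>n\<close> vanish, the left side
  has coefficient \<open>n * g $ n\<close> at \<open>n\<close>, while the right side has 0 because
  \<open>fps_X * fps_deriv f\<close> has no constant term.\<close>

lemma fps_ode_zero:
  fixes f g :: "int fps"
  assumes ode: "f * (fps_X * fps_deriv g) = 4 * (fps_X * fps_deriv f) * g" and "f $ 0 = 1" "g $ 0 = 0"
  shows "g = 0"
proof (rule fps_ext)
  fix n
  show "g $ n = 0 $ n"
  proof (induction n rule: less_induct)
    case (less n)
    have "(f * (fps_X * fps_deriv g)) $ n = (\<Sum>i=0..n. f $ i * (of_nat (n - i) * g $ (n - i)))"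
      unfolding fps_mult_nth[of f] fps_X_deriv_nth ..
    also have "\<dots> = (\<Sum>i\<in>{0}. f $ i * (of_nat (n - i) * g $ (n - i)))"
      by (rule sum.mono_neutral_right) (use less in auto)
    finally have L: "(f * (fps_X * fps_deriv g)) $ n = of_nat n * g $ n"
      using \<open>f $ 0 = 1\<close> by simp
    have "(4 * (fps_X * fps_deriv f) * g) $ n = 4 * (\<Sum>i=0..n. of_nat i * f $ i * g $ (n - i))"
      unfolding mult.assoc[of 4] numeral_fps_const fps_mult_left_const_nth fps_mult_nth[of _ g] fps_X_deriv_nth
      by (simp add: sum_distrib_left)
    also have "(\<Sum>i=0..n. of_nat i * f $ i * g $ (n - i)) = 0"
    proof (rule sum.neutral, rule ballI)
      fix i assume "i \<in> {0..n}"
      then show "of_nat i * f $ i * g $ (n - i) = 0"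
        using less[of "n - i"] by (cases "i = 0") auto
    qed
    finally have "of_nat n * g $ n = 0"
      unfolding L[symmetric] ode by simp
    then show ?case
      using \<open>g $ 0 = 0\<close> by (cases "n = 0") auto
  qed
qed

text \<open>The equation is linear in \<open>sigma_odd\<close>, and both series solve it with
  constant term 1, so their difference vanishes.\<close>

lemma sigma_odd_eq: "sigma_odd = psi ^ 4"
proof -
  have D: "fps_deriv (psi ^ 4) = 4 * fps_deriv psi * psi ^ 3"
    by (simp add: fps_deriv_power flip: numeral_fps_const)
  have "psi * (fps_X * fps_deriv (psi ^ 4)) = 4 * (fps_X * fps_deriv psi) * psi ^ 4"
    unfolding D by (simp add: power4_eq_xxxx power3_eq_cube mult_ac)
  then have "psi * (fps_X * fps_deriv (sigma_odd - psi ^ 4)) = 4 * (fps_X * fps_deriv psi) * (sigma_odd - psi ^ 4)"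
    using sigma_odd_ode by (simp add: algebra_simps)
  moreover have "divisor_pairs 1 = {(1, 1)}"
    by (auto simp: divisor_pairs_def zmult_eq_1_iff)
  then have "(sigma_odd - psi ^ 4) $ 0 = 0"
    by (simp add: sigma_odd_def psi_0 fps_nth_power_0)
  ultimately have "sigma_odd - psi ^ 4 = 0"
    using fps_ode_zero psi_0 by blast
  then show ?thesis by simp
qed

lemma reduced_forms_fps_eq: "reduced_forms_fps = psi ^ 3"
proof -
  have "psi \<noteq> 0" using psi_0 by auto
  moreover have "psi * reduced_forms_fps = psi * psi ^ 3"
    by (simp add: psi_reduced_forms_fps sigma_odd_eq flip: power_Suc)
  ultimately show ?thesis by simp
qed

theorem sum_of_three_triangles: "\<exists>i j l. k = triangle i + triangle j + triangle l"
proof -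
  \<comment> \<open>The witness comes from \<open>4 (2 k + 1) - 1 = 8 k + 3\<close>.\<close>
  have "(1, 1, 2 * int k + 1) \<in> reduced_forms k" by (simp add: reduced_forms_def)
  then have "card (reduced_forms k) \<noteq> 0" using finite_reduced_forms by auto
  then have "reduced_forms_fps $ k \<noteq> 0" by (simp add: reduced_forms_fps_def)
  then have "(psi * (psi * psi)) $ k \<noteq> 0" by (simp add: reduced_forms_fps_eq power3_eq_cube mult.assoc)
  then obtain i where i: "triangle i \<le> k" "(psi * psi) $ (k - triangle i) \<noteq> 0"
    unfolding psi_mult_nth[of "psi * psi"] by (auto elim: sum.not_neutral_contains_not_neutral)
  from i(2) obtain j where j: "triangle j \<le> k - triangle i" "psi $ (k - triangle i - triangle j) \<noteq> 0"
    unfolding psi_mult_nth by (auto elim: sum.not_neutral_contains_not_neutral)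
  from j(2) obtain l where "k - triangle i - triangle j = triangle l"
    by (auto simp: psi_def split: if_splits)
  with i j show ?thesis by (intro exI[of _ i] exI[of _ j] exI[of _ l]) linarith
qed

section \<open>Cauchy's lemma and large numbers\<close>

text \<open>Cauchy-Schwarz: \<open>(x + y + z)\<^sup>2 \<le> 3 (x\<^sup>2 + y\<^sup>2 +
  z\<^sup>2)\<close>.\<close>

lemma signed_sum_bound:
  fixes x y z c :: int
  assumes "3 * (x * x + y * y + z * z) < c * c" "0 \<le> c"
  shows "- c < x + y + z"
proof (rule ccontr)
  assume "\<not> - c < x + y + z"
  then have "c * c \<le> (- (x + y + z)) * (- (x + y + z))"
    using \<open>0 \<le> c\<close> by (intro mult_mono) auto
  moreover have "0 \<le> (x - y) * (x - y)" "0 \<le> (y - z) * (y - z)" "0 \<le> (x - z) * (x - z)"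
    by simp_all
  ultimately show False
    using assms by (simp add: algebra_simps)
qed

lemma sum_of_three_odd_squares:
  fixes m :: int
  assumes "m mod 8 = 3" "0 \<le> m"
  shows "\<exists>x y z. odd x \<and> odd y \<and> odd z \<and> x * x + y * y + z * z = m"
proof -
  obtain i j l where ijl: "nat (m div 8) = triangle i + triangle j + triangle l"
    using sum_of_three_triangles by blast
  have "m = 8 * (m div 8) + 3"
    using assms(1) div_mult_mod_eq[of m 8] by simp
  also have "m div 8 = int (nat (m div 8))"
    using \<open>0 \<le> m\<close> by simp
  finally have "m = (8 * int (triangle i) + 1) + (8 * int (triangle j) + 1) + (8 * int (triangle l) + 1)"
    unfolding ijl by simp
  then show ?thesis
    unfolding triangle_8
    by (intro exI[of _ "2 * int i + 1"] exI[of _ "2 * int j + 1"] exI[of _ "2 * int l + 1"]) simp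
qed

text \<open>Write \<open>4 a - b\<^sup>2\<close> as a sum of three odd squares. With suitable signs
  of the roots, the solution is \<open>(b + x + y + z) / 4\<close>,
  \<open>(b + x - y - z) / 4\<close> and the two analogous quotients.\<close>

lemma Cauchy_lemma:
  fixes a b :: int
  assumes "odd a" "odd b" "0 \<le> b" "b * b < 4 * a" "3 * a < b * b + 2 * b + 4"
  shows "\<exists>w x y z :: nat. int w + int x + int y + int z = b \<and>
    int w * int w + int x * int x + int y * int y + int z * int z = a"
proof -
  have "b * b mod 8 = 1" using \<open>odd b\<close> by (rule odd_square_mod_8)
  moreover have "4 * a mod 8 = 4" using \<open>odd a\<close> by presburger
  ultimately have "(4 * a - b * b) mod 8 = 3" by presburger
  then obtain x y z where xyz: "odd x" "odd y" "odd z" "x * x + y * y + z * z = 4 * a - b * b"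
    using sum_of_three_odd_squares[of "4 * a - b * b"] \<open>b * b < 4 * a\<close> by auto
  \<comment> \<open>The sum is even, and replacing \<open>z\<close> by \<open>- z\<close> changes it
    by 2 modulo 4.\<close>
  obtain z' where z': "odd z'" "z' * z' = z * z" "4 dvd b + x + y + z'"
  proof (cases "4 dvd b + x + y + z")
    case True
    then show ?thesis using that[of z] \<open>odd z\<close> by simp
  next
    case False
    then have "4 dvd b + x + y - z"
      using \<open>odd b\<close> \<open>odd x\<close> \<open>odd y\<close> \<open>odd z\<close> by presburger
    then show ?thesis using that[of "- z"] \<open>odd z\<close> by simp
  qed
  obtain x1 y1 z1 where odds: "x = 2 * x1 + 1" "y = 2 * y1 + 1" "z' = 2 * z1 + 1"
    using \<open>odd x\<close> \<open>odd y\<close> \<open>odd z'\<close> by (elim oddE)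
  obtain s where s: "b + x + y + z' = 4 * s"
    using z'(3) by (elim dvdE)
  \<comment> \<open>Four times the last hypothesis, minus \<open>3 b\<^sup>2\<close>. It makes the
    four numerators exceed -4; being multiples of 4, they are nonnegative.\<close>
  have sq: "3 * (x * x + y * y + z' * z') < (b + 4) * (b + 4)"
    using assms(5) xyz(4) z'(2) by (simp add: algebra_simps)
  have "- (b + 4) < x + y + z'" "- (b + 4) < x + (- y) + (- z')"
    "- (b + 4) < (- x) + y + (- z')" "- (b + 4) < (- x) + (- y) + z'"
    by (rule signed_sum_bound; use sq \<open>0 \<le> b\<close> in simp)+
  then have nonneg: "0 \<le> s" "0 \<le> s - (y1 + z1 + 1)" "0 \<le> s - (x1 + z1 + 1)" "0 \<le> s - (x1 + y1 + 1)"
    using s odds by linarith+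
  have b: "b = 4 * s - x - y - z'" using s by simp
  have "4 * a = b * b + x * x + y * y + z' * z'" using xyz z' by simp
  then have "a = s * s + (s - (y1 + z1 + 1)) * (s - (y1 + z1 + 1)) + (s - (x1 + z1 + 1)) * (s - (x1 + z1 + 1))
      + (s - (x1 + y1 + 1)) * (s - (x1 + y1 + 1))"
    unfolding b odds by (simp add: algebra_simps)
  moreover have "s + (s - (y1 + z1 + 1)) + (s - (x1 + z1 + 1)) + (s - (x1 + y1 + 1)) = b"
    unfolding b odds by simp
  ultimately show ?thesis
    using nonneg by (intro exI[of _ "nat s"] exI[of _ "nat (s - (y1 + z1 + 1))"]
      exI[of _ "nat (s - (x1 + z1 + 1))"] exI[of _ "nat (s - (x1 + y1 + 1))"]) simp
qed

lemma sum_of_four_second_polygonal: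
  fixes a b n :: int
  assumes "odd a" "odd b" "0 \<le> b" "b * b < 4 * a" "3 * a < b * b + 2 * b + 4"
    and n: "2 * n = (int m - 2) * a + (int m - 4) * b"
  shows "\<exists>w x y z. n = second_polygonal m w + second_polygonal m x + second_polygonal m y + second_polygonal m z"
proof -
  obtain w x y z :: nat where "int w + int x + int y + int z = b"
    "int w * int w + int x * int x + int y * int y + int z * int z = a"
    using Cauchy_lemma assms by blast
  then have "2 * (second_polygonal m w + second_polygonal m x + second_polygonal m y + second_polygonal m z) = 2 * n"
    unfolding n distrib_left two_times_second_polygonal by (auto simp: algebra_simps)
  then show ?thesis by (intro exI[of _ w] exI[of _ x] exI[of _ y] exI[of _ z]) simp
qed

text \<open>
  For the largest \<open>b\<close> in a residue class with \<open>b\<^sup>2 < 4 a\<close>, where \<open>a\<close> is the affine function of \<open>b\<close>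
  prescribed by \<open>n\<close>, the second condition of Cauchy's lemma holds as well as soon as \<open>n\<close> is large.
\<close>

lemma last_in_progression:
  fixes c lo d :: int
  assumes "0 < d" and start: "\<And>b. b < lo + d \<Longrightarrow> lo \<le> b \<Longrightarrow> P b" and bound: "\<And>b. P b \<Longrightarrow> b < B"
  obtains q where "lo \<le> c + d * q" "P (c + d * q)" "\<not> P (c + d * q + d)"
proof -
  \<comment> \<open>The representative of \<open>c\<close> modulo \<open>d\<close> in the window
    where \<open>P\<close> is known.\<close>
  define r where "r = lo + (c - lo) mod d"
  have r: "lo \<le> r" "r < lo + d" using \<open>0 < d\<close> by (simp_all add: r_def)
  have "d dvd r - c"
    by (simp add: r_def mod_eq_dvd_iff[symmetric] mod_simps)
  then obtain e where e: "r = c + d * e" by (metis add.commute diff_add_cancel dvdE)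
  have "\<exists>t. P (r + d * int t) \<and> \<not> P (r + d * int (Suc t))"
  proof (rule ccontr)
    assume "\<not> ?thesis"
    then have "P (r + d * int t)" for t
      by (induction t) (use start r in auto)
    then have "r + d * int (nat (B - r)) < B" by (rule bound)
    moreover have "1 * int (nat (B - r)) \<le> d * int (nat (B - r))"
      using \<open>0 < d\<close> by (intro mult_right_mono) auto
    ultimately show False by linarith
  qed
  then obtain t where "P (r + d * int t)" "\<not> P (r + d * int (Suc t))" by blast
  moreover have "lo \<le> r + d * int t"
    using r \<open>0 < d\<close> by (simp add: add_increasing2)
  ultimately show thesis
    using that[of "e + int t"] by (simp add: e algebra_simps)
qed

lemma large_second_pentagonal:
  fixes n :: int
  assumes "533 \<le> n"
  shows "\<exists>w x y z. n = second_polygonal 5 w + second_polygonal 5 x + second_polygonal 5 y + second_polygonal 5 z"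
proof -
  \<comment> \<open>With \<open>2 n = 3 a + b\<close> this says \<open>b\<^sup>2 < 4 a\<close>;
    oddness of \<open>a\<close> and \<open>b\<close> forces \<open>b\<close> into the class of
    \<open>2 n + 3\<close> modulo 6.\<close>
  define P where "P b \<longleftrightarrow> 3 * (b * b) + 4 * b < 8 * n" for b
  \<comment> \<open>\<open>3 * 37\<^sup>2 + 4 * 37 = 4255 < 8 * 533\<close>. From 32 on,
    \<open>b\<^sup>2 > 28 b + 116\<close>, which turns failure of \<open>P (b + 6)\<close> into the
    second Cauchy condition.\<close>
  have "P b" if "32 \<le> b" "b < 32 + 6" for b
  proof -
    have "b * b \<le> 37 * 37" using that by (intro mult_mono) auto
    then show ?thesis using that assms by (simp add: P_def)
  qed
  moreover have "b < 8 * n" if "P b" for b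
  proof -
    have "0 \<le> b * b" by simp
    then show ?thesis using that assms unfolding P_def by linarith
  qed
  ultimately obtain q where q: "32 \<le> 2 * n + 3 + 6 * q" "P (2 * n + 3 + 6 * q)" "\<not> P (2 * n + 3 + 6 * q + 6)"
    using last_in_progression[of 6 32 P "8 * n" "2 * n + 3"] by auto
  define b where "b = 2 * n + 3 + 6 * q"
  define a where "a = - 2 * q - 1"
  have n: "2 * n = 3 * a + b" by (simp add: a_def b_def)
  have b: "32 \<le> b" "3 * (b * b) + 4 * b < 8 * n" "8 * n \<le> 3 * (b * b) + 40 * b + 132"
    using q unfolding P_def b_def[symmetric] by (auto simp: algebra_simps)
  have "32 * b \<le> b * b" using b by (intro mult_right_mono) auto
  with b n have "b * b < 4 * a" "3 * a < b * b + 2 * b + 4" by linarith+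
  moreover have "odd a" "odd b" by (simp_all add: a_def b_def)
  ultimately show ?thesis
    using b(1) n by (intro sum_of_four_second_polygonal[of a b]) auto
qed

lemma large_second_heptagonal:
  fixes n :: int
  assumes "2993 \<le> n"
  shows "\<exists>w x y z. n = second_polygonal 7 w + second_polygonal 7 x + second_polygonal 7 y + second_polygonal 7 z"
proof -
  \<comment> \<open>Again \<open>b\<^sup>2 < 4 a\<close>, now with \<open>2 n = 5 a + 3 b\<close>,
    which puts \<open>b\<close> into the class of \<open>4 n + 5\<close> modulo 10.\<close>
  define P where "P b \<longleftrightarrow> 5 * (b * b) + 12 * b < 8 * n" for b
  \<comment> \<open>\<open>5 * 68\<^sup>2 + 12 * 68 = 23936 < 8 * 2993\<close>, and
    \<open>b\<^sup>2 > 52 b + 356\<close> from 59 on.\<close>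
  have "P b" if "59 \<le> b" "b < 59 + 10" for b
  proof -
    have "b * b \<le> 68 * 68" using that by (intro mult_mono) auto
    then show ?thesis using that assms by (simp add: P_def)
  qed
  moreover have "b < 8 * n" if "P b" for b
  proof -
    have "0 \<le> b * b" by simp
    then show ?thesis using that assms unfolding P_def by linarith
  qed
  ultimately obtain q where q: "59 \<le> 4 * n + 5 + 10 * q" "P (4 * n + 5 + 10 * q)" "\<not> P (4 * n + 5 + 10 * q + 10)"
    using last_in_progression[of 10 59 P "8 * n" "4 * n + 5"] by auto
  define b where "b = 4 * n + 5 + 10 * q"
  define a where "a = - 2 * n - 6 * q - 3"
  have n: "2 * n = 5 * a + 3 * b" by (simp add: a_def b_def)
  have b: "59 \<le> b" "5 * (b * b) + 12 * b < 8 * n" "8 * n \<le> 5 * (b * b) + 112 * b + 620"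
    using q unfolding P_def b_def[symmetric] by (auto simp: algebra_simps)
  have "59 * b \<le> b * b" using b by (intro mult_right_mono) auto
  with b n have "b * b < 4 * a" "3 * a < b * b + 2 * b + 4" by linarith+
  moreover have "odd a" "odd b" by (simp_all add: a_def b_def)
  ultimately show ?thesis
    using b(1) n by (intro sum_of_four_second_polygonal[of a b]) auto
qed

section \<open>Small numbers\<close>

text \<open>The early exit is only justified for a decreasing list; soundness does not depend on it.\<close>

fun rep :: "nat \<Rightarrow> int \<Rightarrow> int list \<Rightarrow> bool" where
  "rep 0 n xs = (n = 0)"
| "rep (Suc k) n [] = False"
| "rep (Suc k) n (x # xs) =
    (if n < x then rep (Suc k) n xs else if int (Suc k) * x < n then False
     else if rep k (n - x) (x # xs) then True else rep (Suc k) n xs)"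

lemma rep_sound: "rep k n xs \<Longrightarrow> \<exists>ys. length ys = k \<and> set ys \<subseteq> set xs \<and> sum_list ys = n"
proof (induction k n xs rule: rep.induct)
  case (3 k n x xs)
  then consider "rep (Suc k) n xs" "n < x \<or> \<not> n < x \<and> \<not> int (Suc k) * x < n \<and> \<not> rep k (n - x) (x # xs)"
    | "\<not> n < x" "\<not> int (Suc k) * x < n" "rep k (n - x) (x # xs)"
    by (auto split: if_splits)
  then show ?case
  proof cases
    case 1
    with 3 obtain ys where "length ys = Suc k" "set ys \<subseteq> set xs" "sum_list ys = n" by blast
    then show ?thesis by (intro exI[of _ ys]) auto
  next
    case 2
    with 3 obtain ys where "length ys = k" "set ys \<subseteq> set (x # xs)" "sum_list ys = n - x" by blast
    then show ?thesis by (intro exI[of _ "x # ys"]) auto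
  qed
qed auto

definition all_rep :: "int list \<Rightarrow> int list \<Rightarrow> bool" where
  "all_rep xs ns \<longleftrightarrow> list_all (\<lambda>n. rep 4 n xs) ns"

lemma all_rep_sound:
  assumes "all_rep (map f is) ns" "n \<in> set ns"
  shows "\<exists>w x y z. n = f w + f x + f y + f z"
proof -
  have "rep 4 n (map f is)" using assms by (auto simp: all_rep_def list_all_iff)
  then obtain ys where ys: "length ys = 4" "set ys \<subseteq> f ` set is" "sum_list ys = n"
    using rep_sound by fastforce
  then obtain p q r s where "ys = [p, q, r, s]"
    by (auto simp: length_Suc_conv numeral_eq_Suc)
  with ys have "p \<in> f ` set is" "q \<in> f ` set is" "r \<in> f ` set is" "s \<in> f ` set is" "n = p + q + r + s"
    by auto
  then show ?thesis by blast
qed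

lemma small_second_pentagonal:
  "all_rep (map (second_polygonal 5) (rev [0..<19]))
    (filter (\<lambda>n. n \<notin> {1, 3, 5, 10, 12, 20, 25, 27, 38, 53, 65, 153, 165}) [0..532])"
  by code_simp

text \<open>Each list contains all values up to the end of its range, in decreasing order as the
  early exit of \<open>rep\<close> expects.\<close>

lemma small_second_heptagonal:
  "all_rep (map (second_polygonal 7) (rev [0..<26])) [786..1500]"
  "all_rep (map (second_polygonal 7) (rev [0..<30])) [1501..2000]"
  "all_rep (map (second_polygonal 7) (rev [0..<33])) [2001..2500]"
  "all_rep (map (second_polygonal 7) (rev [0..<35])) [2501..2992]"
  by code_simp+

section \<open>The exceptional values are not attained\<close>

lemma second_polygonal_5_nonneg: "0 \<le> second_polygonal 5 n"
  unfolding second_polygonal_5 by (intro pos_imp_zdiv_nonneg_iff[THEN iffD2]) auto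

text \<open>The value at 11 is already 187.\<close>

lemma second_polygonal_5_le:
  assumes "second_polygonal 5 n \<le> 165"
  shows "n < 11"
proof (rule ccontr)
  assume "\<not> n < 11"
  then have "11 * 34 \<le> int n * (3 * int n + 1)"
    by (intro mult_mono) auto
  also have "\<dots> = 2 * second_polygonal 5 n"
    using two_times_second_polygonal[of 5 n] by simp
  finally show False using assms by simp
qed

text \<open>Pairing the summands and removing repeated sums avoids a search through all
  \<open>11^4\<close> quadruples.\<close>

definition second_pentagonal_pairs :: "int list" where
  "second_pentagonal_pairs =
    remdups (concat (map (\<lambda>w. map (\<lambda>x. second_polygonal 5 w + second_polygonal 5 x) [0..<11]) [0..<11]))"

lemma exceptional_check:
  "list_all (\<lambda>s. list_all (\<lambda>t. s + t \<notin> {1, 3, 5, 10, 12, 20, 25, 27, 38, 53, 65, 153, 165})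
    second_pentagonal_pairs) second_pentagonal_pairs"
  by code_simp

lemma exceptional_second_pentagonal:
  "second_polygonal 5 w + second_polygonal 5 x + second_polygonal 5 y + second_polygonal 5 z
    \<notin> {1, 3, 5, 10, 12, 20, 25, 27, 38, 53, 65, 153, 165}" (is "?s \<notin> ?A")
proof
  assume s: "?s \<in> ?A"
  then have "?s \<le> 165" by auto
  then have "w < 11" "x < 11" "y < 11" "z < 11"
    using second_polygonal_5_nonneg[of w] second_polygonal_5_nonneg[of x]
      second_polygonal_5_nonneg[of y] second_polygonal_5_nonneg[of z]
    by (auto intro!: second_polygonal_5_le)
  moreover have "second_polygonal 5 i + second_polygonal 5 j \<in> set second_pentagonal_pairs"
    if "i < 11" "j < 11" for i j
    using that unfolding second_pentagonal_pairs_def by (auto intro!: bexI[of _ i] imageI)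
  ultimately have "second_polygonal 5 w + second_polygonal 5 x \<in> set second_pentagonal_pairs"
    "second_polygonal 5 y + second_polygonal 5 z \<in> set second_pentagonal_pairs"
    by blast+
  then have "(second_polygonal 5 w + second_polygonal 5 x) + (second_polygonal 5 y + second_polygonal 5 z) \<notin> ?A"
    using exceptional_check unfolding list_all_iff by blast
  with s show False
    unfolding add.assoc by contradiction
qed

theorem corollary1:
  shows "{second_polygonal 5 w + second_polygonal 5 x + second_polygonal 5 y + second_polygonal 5 z
            | w x y z :: nat. True}
         = \<nat> - {1, 3, 5, 10, 12, 20, 25, 27, 38, 53, 65, 153, 165}
       \<and> (\<forall>n::int. n \<ge> 786 \<longrightarrow>
           (\<exists>w x y z :: nat. n = second_polygonal 7 w + second_polygonal 7 x
                               + second_polygonal 7 y + second_polygonal 7 z))"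
proof (intro conjI allI impI subset_antisym subsetI)
  fix n :: int
  assume "n \<in> {second_polygonal 5 w + second_polygonal 5 x + second_polygonal 5 y + second_polygonal 5 z
            | w x y z :: nat. True}"
  then obtain w x y z where
    "n = second_polygonal 5 w + second_polygonal 5 x + second_polygonal 5 y + second_polygonal 5 z"
    by blast
  then have "0 \<le> n" "n \<notin> {1, 3, 5, 10, 12, 20, 25, 27, 38, 53, 65, 153, 165}"
    using exceptional_second_pentagonal[of w x y z] by (simp_all add: second_polygonal_5_nonneg)
  moreover from \<open>0 \<le> n\<close> have "n \<in> \<nat>"
    by (metis nat_0_le of_nat_in_Nats)
  ultimately show "n \<in> \<nat> - {1, 3, 5, 10, 12, 20, 25, 27, 38, 53, 65, 153, 165}"
    by blast
next
  fix n :: int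
  assume n: "n \<in> \<nat> - {1, 3, 5, 10, 12, 20, 25, 27, 38, 53, 65, 153, 165}"
  then have "0 \<le> n" by (auto simp: Nats_altdef2)
  have "\<exists>w x y z. n = second_polygonal 5 w + second_polygonal 5 x + second_polygonal 5 y + second_polygonal 5 z"
  proof (cases "533 \<le> n")
    case True
    then show ?thesis by (rule large_second_pentagonal)
  next
    case False
    with n \<open>0 \<le> n\<close> show ?thesis
      by (intro all_rep_sound[OF small_second_pentagonal]) simp
  qed
  then show "n \<in> {second_polygonal 5 w + second_polygonal 5 x + second_polygonal 5 y + second_polygonal 5 z
            | w x y z :: nat. True}"
    by blast
next
  fix n :: int
  assume "786 \<le> n"
  then consider "n \<in> set [786..1500]" | "n \<in> set [1501..2000]" | "n \<in> set [2001..2500]" | "n \<in> set [2501..2992]"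
    | "2993 \<le> n"
    unfolding set_upto atLeastAtMost_iff by linarith
  then show "\<exists>w x y z. n = second_polygonal 7 w + second_polygonal 7 x + second_polygonal 7 y + second_polygonal 7 z"
    by cases (blast intro: large_second_heptagonal all_rep_sound small_second_heptagonal)+
qed

end
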